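(* Let $Q\in\mathbb{R}^{n\times n}$ be an orthogonal matrix that is hollow. Then $Q$ has the strong inner product property if and only if $Q$ is not signature equivalent to a symmetric hollow matrix.
   Context: All matrices are real; $\circ$ denotes the Hadamard product. A matrix $M\in\mathbb{R}^{n\times n}$ has the strong inner product property (SIPP) if $M$ has rank $n$ and $X=O$ is the only symmetric $n\times n$ matrix $X$ with $(XM)\circ M=O$. A hollow matrix is a square matrix with all diagonal entries zero and all off-diagonal entries nonzero. A signature matrix is a diagonal matrix with diagonal entries in $\{1,-1\}$. Matrices $A,B$ are signature equivalent if $A=D_1BD_2$ for some signature matrices $D_1,D_2$. *)

theory Defs
  imports "HOL-Analysis.Analysis"
begin

definition hadamard :: "real^'n^'m \<Rightarrow> real^'n^'m \<Rightarrow> real^'n^'m" where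
  "hadamard A B = (\<chi> i j. A $ i $ j * B $ i $ j)"

definition symmetric_matrix :: "real^'n^'n \<Rightarrow> bool" where
  "symmetric_matrix A \<longleftrightarrow> transpose A = A"

definition SIPP :: "real^'n^'n \<Rightarrow> bool" where
  "SIPP M \<longleftrightarrow> rank M = CARD('n) \<and>
     (\<forall>X :: real^'n^'n. symmetric_matrix X \<and> hadamard (X ** M) M = 0 \<longrightarrow> X = 0)"

definition hollow :: "real^'n^'n \<Rightarrow> bool" where
  "hollow A \<longleftrightarrow> (\<forall>i. A $ i $ i = 0) \<and> (\<forall>i j. i \<noteq> j \<longrightarrow> A $ i $ j \<noteq> 0)"

definition signature_matrix :: "real^'n^'n \<Rightarrow> bool" where
  "signature_matrix D \<longleftrightarrow>
     (\<forall>i j. i \<noteq> j \<longrightarrow> D $ i $ j = 0) \<and> (\<forall>i. D $ i $ i \<in> {1, -1})"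

definition signature_equivalent :: "real^'n^'n \<Rightarrow> real^'n^'n \<Rightarrow> bool" where
  "signature_equivalent A B \<longleftrightarrow>
     (\<exists>D\<^sub>1 D\<^sub>2. signature_matrix D\<^sub>1 \<and> signature_matrix D\<^sub>2 \<and> A = D\<^sub>1 ** B ** D\<^sub>2)"

end

theory Submission
  imports Defs
begin

text \<open>
  For hollow \<open>Q\<close>, the condition \<open>(XQ) \<circ> Q = 0\<close> says that \<open>XQ\<close> is a diagonal matrix \<open>D\<close>. If \<open>Q\<close>
  is orthogonal then \<open>X = DQ\<^sup>T\<close>, so the SIPP fails exactly when \<open>QD\<close> is symmetric for some diagonal
  \<open>D \<noteq> 0\<close>. Squaring the symmetry relation and summing along a row shows that the vector of the
  \<open>d\<^sub>i\<^sup>2\<close> is fixed by the doubly stochastic matrix with entries \<open>q\<^sub>i\<^sub>j\<^sup>2\<close>. All its off-diagonal entries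
  are positive, so by the maximum principle all \<open>d\<^sub>i\<^sup>2\<close> agree, and \<open>D\<close> is a nonzero multiple of a
  signature matrix.
\<close>

definition diagonal_matrix :: "('n \<Rightarrow> real) \<Rightarrow> real^'n^'n" where
  "diagonal_matrix d = (\<chi> i j. if i = j then d i else 0)"

lemma matrix_mult_diagonal_nth:
  "(A ** diagonal_matrix d) $ i $ j = A $ i $ j * d j"
  by (simp add: diagonal_matrix_def matrix_matrix_mult_def if_distrib cong: if_cong)

lemma diagonal_matrix_mult_nth:
  "(diagonal_matrix d ** A) $ i $ j = d i * A $ i $ j"
  by (simp add: diagonal_matrix_def matrix_matrix_mult_def if_distrib[where f = "\<lambda>x. x * _"]
      cong: if_cong)

lemma transpose_diagonal_matrix [simp]: "transpose (diagonal_matrix d) = diagonal_matrix d"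
  by (simp add: diagonal_matrix_def transpose_def vec_eq_iff)

lemma signature_matrix_iff_diagonal:
  "signature_matrix D \<longleftrightarrow> (\<exists>d. (\<forall>i. d i \<in> {1, -1}) \<and> D = diagonal_matrix d)"
proof
  assume "signature_matrix D"
  then show "\<exists>d. (\<forall>i. d i \<in> {1, -1}) \<and> D = diagonal_matrix d"
    by (intro exI[of _ "\<lambda>i. D $ i $ i"])
      (auto simp: signature_matrix_def diagonal_matrix_def vec_eq_iff)
next
  assume "\<exists>d. (\<forall>i. d i \<in> {1, -1}) \<and> D = diagonal_matrix d"
  then show "signature_matrix D"
    by (auto simp: signature_matrix_def diagonal_matrix_def)
qed

lemma symmetric_matrix_iff: "symmetric_matrix A \<longleftrightarrow> (\<forall>i j. A $ i $ j = A $ j $ i)"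
  by (auto simp: symmetric_matrix_def transpose_def vec_eq_iff)

text \<open>The nonzero off-diagonal entries of \<open>Q\<close> force the off-diagonal entries of
  \<open>A\<close> to vanish, while the zero diagonal of \<open>Q\<close> leaves the diagonal of
  \<open>A\<close> unconstrained.\<close>

lemma hadamard_hollow_eq_0_iff:
  assumes "hollow Q"
  shows "hadamard A Q = 0 \<longleftrightarrow> (\<exists>d. A = diagonal_matrix d)"
proof
  assume "hadamard A Q = 0"
  then have "A $ i $ j = 0" if "i \<noteq> j" for i j
    using assms that by (simp add: hadamard_def hollow_def vec_eq_iff) metis
  then have "A = diagonal_matrix (\<lambda>i. A $ i $ i)"
    by (auto simp: diagonal_matrix_def vec_eq_iff)
  then show "\<exists>d. A = diagonal_matrix d" by blast
next
  assume "\<exists>d. A = diagonal_matrix d"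
  then show "hadamard A Q = 0"
    using assms by (auto simp: hadamard_def hollow_def diagonal_matrix_def vec_eq_iff)
qed

lemma rank_orthogonal_matrix:
  fixes Q :: "real^'n^'n"
  assumes "orthogonal_matrix Q"
  shows "rank Q = CARD('n)"
proof -
  have "invertible Q"
    using assms by (auto simp: orthogonal_matrix_def invertible_def)
  then have "surj ((*v) Q)"
    by (metis invertible_def matrix_right_invertible_surjective)
  then show ?thesis
    by (simp add: full_rank_surjective)
qed

text \<open>An orthogonal matrix has full rank, so the SIPP can only fail through a nonzero
  symmetric \<open>X\<close>. This trades \<open>X\<close> for the diagonal of
  \<open>X ** Q\<close>, leaving one unknown per index.\<close>

lemma not_SIPP_orthogonal_hollow_iff:
  fixes Q :: "real^'n^'n"
  assumes orth: "orthogonal_matrix Q" and "hollow Q"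
  shows "\<not> SIPP Q \<longleftrightarrow>
    (\<exists>d. (\<exists>i. d i \<noteq> 0) \<and> symmetric_matrix (Q ** diagonal_matrix d))"
proof
  assume "\<not> SIPP Q"
  then obtain X where X: "symmetric_matrix X" "hadamard (X ** Q) Q = 0" "X \<noteq> 0"
    using rank_orthogonal_matrix[OF orth] by (auto simp: SIPP_def)
  then obtain d where d: "X ** Q = diagonal_matrix d"
    using hadamard_hollow_eq_0_iff[OF \<open>hollow Q\<close>] by blast
  have "X = diagonal_matrix d ** transpose Q"
    using orth by (metis d matrix_mul_assoc matrix_mul_rid orthogonal_matrix_def)
  \<comment> \<open>Transpose the previous equation; \<open>X\<close> is its own transpose.\<close>
  then have X_eq: "X = Q ** diagonal_matrix d"
    using X(1) by (metis matrix_transpose_mul symmetric_matrix_def transpose_diagonal_matrix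
        transpose_transpose)
  then have "\<exists>i. d i \<noteq> 0"
    using \<open>X \<noteq> 0\<close> by (auto simp: vec_eq_iff matrix_mult_diagonal_nth)
  then show "\<exists>d. (\<exists>i. d i \<noteq> 0) \<and> symmetric_matrix (Q ** diagonal_matrix d)"
    using X(1) X_eq by blast
next
  assume "\<exists>d. (\<exists>i. d i \<noteq> 0) \<and> symmetric_matrix (Q ** diagonal_matrix d)"
  then obtain d k where d: "d k \<noteq> 0" and sym: "symmetric_matrix (Q ** diagonal_matrix d)"
    by blast
  \<comment> \<open>The violating matrix is \<open>X = Q ** diagonal_matrix d\<close>. Symmetry
    moves \<open>Q\<close> to the right as a transpose, where it cancels against the factor
    \<open>Q\<close> in \<open>X ** Q\<close>.\<close>
  have "Q ** diagonal_matrix d = diagonal_matrix d ** transpose Q"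
    using sym by (metis matrix_transpose_mul symmetric_matrix_def transpose_diagonal_matrix)
  then have XQ: "Q ** diagonal_matrix d ** Q = diagonal_matrix d"
    using orth by (metis matrix_mul_assoc matrix_mul_rid orthogonal_matrix_def)
  have "diagonal_matrix d \<noteq> 0"
    using d by (auto simp: diagonal_matrix_def vec_eq_iff)
  moreover have "0 ** Q = 0"
    by (simp add: matrix_matrix_mult_def vec_eq_iff)
  ultimately have "Q ** diagonal_matrix d \<noteq> 0"
    using XQ by metis
  then show "\<not> SIPP Q"
    using sym XQ hadamard_hollow_eq_0_iff[OF \<open>hollow Q\<close>] by (metis SIPP_def)
qed

lemma orthogonal_matrix_column_sum_squares:
  fixes Q :: "real^'n^'n"
  assumes "orthogonal_matrix Q"
  shows "(\<Sum>j\<in>UNIV. (Q $ j $ i)\<^sup>2) = 1"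
proof -
  have "(transpose Q ** Q) $ i $ i = 1"
    using assms by (simp add: orthogonal_matrix_def mat_def)
  then show ?thesis
    by (simp add: matrix_matrix_mult_def transpose_def power2_eq_square)
qed

lemma orthogonal_matrix_row_sum_squares:
  fixes Q :: "real^'n^'n"
  assumes "orthogonal_matrix Q"
  shows "(\<Sum>j\<in>UNIV. (Q $ i $ j)\<^sup>2) = 1"
proof -
  have "orthogonal_matrix (transpose Q)"
    using assms by simp
  from orthogonal_matrix_column_sum_squares[OF this, of i] show ?thesis
    by (simp add: transpose_def)
qed

lemma symmetrizing_diagonal_abs_const:
  fixes Q :: "real^'n^'n"
  assumes orth: "orthogonal_matrix Q" and "hollow Q"
    and sym: "symmetric_matrix (Q ** diagonal_matrix d)"
  shows "\<bar>d i\<bar> = \<bar>d j\<bar>"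
proof -
  have rel: "Q $ i $ j * d j = Q $ j $ i * d i" for i j
    using sym by (simp add: symmetric_matrix_iff matrix_mult_diagonal_nth)
  have fixed: "(\<Sum>j\<in>UNIV. (Q $ i $ j)\<^sup>2 * (d j)\<^sup>2) = (d i)\<^sup>2" for i
  proof -
    \<comment> \<open>Squaring \<open>rel\<close> turns a weighted sum along row \<open>i\<close>
      into a constant multiple of the squared norm of column \<open>i\<close>.\<close>
    have "(\<Sum>j\<in>UNIV. (Q $ i $ j)\<^sup>2 * (d j)\<^sup>2) = (\<Sum>j\<in>UNIV. (Q $ j $ i)\<^sup>2 * (d i)\<^sup>2)"
      by (intro sum.cong refl) (simp only: rel[of i] flip: power_mult_distrib)
    also have "\<dots> = (d i)\<^sup>2"
      using orthogonal_matrix_column_sum_squares[OF orth, of i]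
      by (simp flip: sum_distrib_right)
    finally show ?thesis .
  qed
  define m where "m = Max (range (\<lambda>i. (d i)\<^sup>2))"
  have le_m: "(d j)\<^sup>2 \<le> m" for j
    by (simp add: m_def)
  have "m \<in> range (\<lambda>i. (d i)\<^sup>2)"
    unfolding m_def by (intro Max_in) auto
  then obtain k where k: "(d k)\<^sup>2 = m"
    by auto
  \<comment> \<open>Row \<open>k\<close> has weights summing to 1, so the maximum \<open>m\<close>
    is a weighted average of the squares; the deficits are nonnegative, hence every weighted deficit
    vanishes.\<close>
  have "(\<Sum>j\<in>UNIV. (Q $ k $ j)\<^sup>2 * (m - (d j)\<^sup>2)) = 0"
    using fixed[of k] orthogonal_matrix_row_sum_squares[OF orth, of k] k
    by (simp add: right_diff_distrib sum_subtractf flip: sum_distrib_right)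
  then have "(Q $ k $ j)\<^sup>2 * (m - (d j)\<^sup>2) = 0" for j
    using le_m by (subst (asm) sum_nonneg_eq_0_iff) auto
  \<comment> \<open>The weight at \<open>j = k\<close> is zero and gives no information; there the
    choice of \<open>k\<close> is used.\<close>
  then have "(d j)\<^sup>2 = m" for j
    using \<open>hollow Q\<close> k by (cases "j = k") (simp_all add: hollow_def, metis)
  then have "(d i)\<^sup>2 = (d j)\<^sup>2" by simp
  then show ?thesis
    by (simp add: power2_eq_iff abs_eq_iff)
qed

text \<open>Two signature factors reduce to one because congruence by a signature matrix preserves
  symmetry.\<close>

lemma signature_equivalent_symmetric_hollow_iff:
  fixes Q :: "real^'n^'n"
  assumes "hollow Q"
  shows "(\<exists>B. symmetric_matrix B \<and> hollow B \<and> signature_equivalent Q B) \<longleftrightarrow>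
    (\<exists>s. (\<forall>i. s i \<in> {1, -1}) \<and> symmetric_matrix (Q ** diagonal_matrix s))"
proof
  assume "\<exists>B. symmetric_matrix B \<and> hollow B \<and> signature_equivalent Q B"
  then obtain B a b where B: "symmetric_matrix B"
    and ab: "\<And>i. a i \<in> {1, -1 :: real}" "\<And>i. b i \<in> {1, -1 :: real}"
    and Q: "Q = diagonal_matrix a ** B ** diagonal_matrix b"
    unfolding signature_equivalent_def signature_matrix_iff_diagonal by blast
  have sq: "b i * b i = 1" for i
    using ab(2)[of i] by auto
  \<comment> \<open>The factor \<open>b\<close> cancels the right signature of \<open>Q\<close>, and
    \<open>a\<close> completes the left one to a congruence of \<open>B\<close>.\<close>
  have "(Q ** diagonal_matrix (\<lambda>i. a i * b i)) $ i $ j = a i * B $ i $ j * a j * (b j * b j)" for i j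
    by (simp add: Q matrix_mult_diagonal_nth diagonal_matrix_mult_nth)
  then have "symmetric_matrix (Q ** diagonal_matrix (\<lambda>i. a i * b i))"
    using B by (simp add: symmetric_matrix_iff sq mult_ac)
  moreover have "a i * b i \<in> {1, -1}" for i
    using ab(1)[of i] ab(2)[of i] by auto
  ultimately show "\<exists>s. (\<forall>i. s i \<in> {1, -1}) \<and> symmetric_matrix (Q ** diagonal_matrix s)"
    by (intro exI[of _ "\<lambda>i. a i * b i"]) blast
next
  assume "\<exists>s. (\<forall>i. s i \<in> {1, -1}) \<and> symmetric_matrix (Q ** diagonal_matrix s)"
  then obtain s where s: "\<And>i. s i \<in> {1, -1}" and sym: "symmetric_matrix (Q ** diagonal_matrix s)"
    by blast
  have sq: "s i * s i = 1" and nz: "s i \<noteq> 0" for i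
    using s[of i] by auto
  have "hollow (Q ** diagonal_matrix s)"
    using assms nz by (simp add: hollow_def matrix_mult_diagonal_nth)
  moreover have "signature_matrix (diagonal_matrix (\<lambda>_. 1))" "signature_matrix (diagonal_matrix s)"
    using s by (auto simp: signature_matrix_def diagonal_matrix_def)
  \<comment> \<open>The left signature is the identity, and the right one is its own
    inverse.\<close>
  moreover have "Q = diagonal_matrix (\<lambda>_. 1) ** (Q ** diagonal_matrix s) ** diagonal_matrix s"
    by (simp add: vec_eq_iff matrix_mult_diagonal_nth diagonal_matrix_mult_nth mult.assoc sq)
  ultimately show "\<exists>B. symmetric_matrix B \<and> hollow B \<and> signature_equivalent Q B"
    using sym unfolding signature_equivalent_def by blast
qed

theorem theorem5p7:
  fixes Q :: "real^'n^'n"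
  assumes "orthogonal_matrix Q" and "hollow Q"
  shows "SIPP Q \<longleftrightarrow>
    \<not> (\<exists>B :: real^'n^'n. symmetric_matrix B \<and> hollow B \<and> signature_equivalent Q B)"
proof -
  have "(\<exists>d. (\<exists>i. d i \<noteq> 0) \<and> symmetric_matrix (Q ** diagonal_matrix d)) \<longleftrightarrow>
    (\<exists>s. (\<forall>i. s i \<in> {1, -1}) \<and> symmetric_matrix (Q ** diagonal_matrix s))"
  proof
    assume "\<exists>d. (\<exists>i. d i \<noteq> 0) \<and> symmetric_matrix (Q ** diagonal_matrix d)"
    then obtain d k where k: "d k \<noteq> 0" and sym: "symmetric_matrix (Q ** diagonal_matrix d)"
      by blast
    \<comment> \<open>Dividing by any nonzero entry normalises the common absolute value to 1, and
      scaling keeps the product symmetric.\<close>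
    have "d i / d k \<in> {1, -1}" for i
      using symmetrizing_diagonal_abs_const[OF assms sym, of i k] k by (auto simp: abs_eq_iff)
    moreover have "symmetric_matrix (Q ** diagonal_matrix (\<lambda>i. d i / d k))"
      using sym by (simp add: symmetric_matrix_iff matrix_mult_diagonal_nth)
    ultimately show "\<exists>s. (\<forall>i. s i \<in> {1, -1}) \<and> symmetric_matrix (Q ** diagonal_matrix s)"
      by (intro exI[of _ "\<lambda>i. d i / d k"]) blast
  next
    assume "\<exists>s. (\<forall>i. s i \<in> {1, -1}) \<and> symmetric_matrix (Q ** diagonal_matrix s)"
    then obtain s where "\<And>i. s i \<in> {1, -1}" and "symmetric_matrix (Q ** diagonal_matrix s)"
      by blast
    \<comment> \<open>Any index serves as the nonzero entry; \<open>undefined\<close> merely names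
      one.\<close>
    moreover from this(1) have "s undefined \<noteq> 0"
      by (metis insertE one_neq_zero singletonD zero_neq_neg_one)
    ultimately show "\<exists>d. (\<exists>i. d i \<noteq> 0) \<and> symmetric_matrix (Q ** diagonal_matrix d)"
      by blast
  qed
  then show ?thesis
    using not_SIPP_orthogonal_hollow_iff[OF assms]
      signature_equivalent_symmetric_hollow_iff[OF assms(2)] by blast
qed

end
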